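(* There is no isomorphism (in the category of pcas and applicative morphisms) between the pcas $2^\omega$ and $\mathcal{K}_2$.
   Context: A partial combinatory algebra (pca) is a set $\mathcal{A}$ with a partial binary application $(a,b)\mapsto ab$ (associating to the left) such that there are $\mathsf{k},\mathsf{s}\in\mathcal{A}$ with, for all $a,b,c$: $\mathsf{k}ab=a$; $\mathsf{s}ab$ is defined; and whenever $(ac)(bc)$ is defined, $\mathsf{s}abc$ is defined and equals $(ac)(bc)$. An applicative morphism $\gamma:\mathcal{A}\to\mathcal{B}$ of pcas assigns to every $a\in\mathcal{A}$ a nonempty subset $\gamma(a)\subseteq\mathcal{B}$ such that there is $r\in\mathcal{B}$ with: whenever $aa'$ is defined in $\mathcal{A}$, $b\in\gamma(a)$, $b'\in\gamma(a')$, then $rbb'$ is defined and lies in $\gamma(aa')$. Composition is composition of relations and identities are identity relations; an isomorphism is an applicative morphism with a two-sided inverse applicative morphism, both composites being equal to the identity relations. Below $[\cdot,\ldots,\cdot]$ is a standard coding of finite sequences of natural numbers by natural numbers. $\mathcal{K}_2$ (Kleene's second model): underlying set $\mathbb{N}^{\mathbb{N}}$; $\alpha\beta$ is defined iff for every $n$ there is $k$ with $\alpha([n,\beta(0),\ldots,\beta(k-1)])>0$, and then $(\alpha\beta)(n)=\alpha([n,\beta(0),\ldots,\beta(k-1)])-1$ for the least such $k$. $2^\omega$: underlying set $\{0,1\}^{\mathbb{N}}$; $\alpha\cdot\beta$ is defined iff for every $n$ there is $k$ with $\alpha([n,\beta(0),\ldots,\beta(k-1)])=1$, and then $(\alpha\cdot\beta)(n)=\alpha([n,\beta(0),\ldots,\beta(k)])$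 for the least such $k$. *)

theory Defs
  imports Main "HOL-Library.Nat_Bijection"
begin

section \<open>Partial combinatory algebras and applicative morphisms\<close>

text \<open>\<open>app A a b = None\<close> means that \<open>ab\<close> is undefined. The field \<open>app\<close> is only relevant
  on arguments in the carrier.\<close>

record 'a pas =
  carrier :: "'a set"
  app :: "'a \<Rightarrow> 'a \<Rightarrow> 'a option"

text \<open>Application of possibly undefined terms, strict in both arguments.\<close>

definition papp :: "('a, 'm) pas_scheme \<Rightarrow> 'a option \<Rightarrow> 'a option \<Rightarrow> 'a option" where
  "papp A x y = Option.bind x (\<lambda>a. Option.bind y (\<lambda>b. app A a b))"

definition pca :: "('a, 'm) pas_scheme \<Rightarrow> bool" where
  "pca A \<longleftrightarrow>
     (\<forall>a\<in>carrier A. \<forall>b\<in>carrier A. \<forall>c. app A a b = Some c \<longrightarrow> c \<in> carrier A) \<and>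
     (\<exists>k\<in>carrier A. \<exists>s\<in>carrier A. \<forall>a\<in>carrier A. \<forall>b\<in>carrier A. \<forall>c\<in>carrier A.
        papp A (papp A (Some k) (Some a)) (Some b) = Some a \<and>
        papp A (papp A (Some s) (Some a)) (Some b) \<noteq> None \<and>
        (papp A (papp A (Some a) (Some c)) (papp A (Some b) (Some c)) \<noteq> None \<longrightarrow>
         papp A (papp A (papp A (Some s) (Some a)) (Some b)) (Some c) =
         papp A (papp A (Some a) (Some c)) (papp A (Some b) (Some c))))"

text \<open>A morphism is given as the relation \<open>{(a, b). b \<in> \<gamma>(a)}\<close>, so that \<open>\<gamma>(a)\<close> is
  \<open>\<gamma> `` {a}\<close>. Being a morphism involves only the applicative structure; that the two
  structures considered here satisfy \<open>pca\<close> is proved separately below.\<close>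

definition applicative_morphism ::
  "('a, 'm) pas_scheme \<Rightarrow> ('b, 'n) pas_scheme \<Rightarrow> ('a \<times> 'b) set \<Rightarrow> bool" where
  "applicative_morphism A B \<gamma> \<longleftrightarrow>
     \<gamma> \<subseteq> carrier A \<times> carrier B \<and>
     (\<forall>a\<in>carrier A. \<gamma> `` {a} \<noteq> {}) \<and>
     (\<exists>r\<in>carrier B. \<forall>a\<in>carrier A. \<forall>a'\<in>carrier A. \<forall>c. app A a a' = Some c \<longrightarrow>
        (\<forall>b\<in>\<gamma> `` {a}. \<forall>b'\<in>\<gamma> `` {a'}.
           \<exists>d\<in>\<gamma> `` {c}. papp B (papp B (Some r) (Some b)) (Some b') = Some d))"

text \<open>Composition of morphisms is \<open>O\<close>, in diagrammatic order.\<close>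

definition applicative_isomorphism ::
  "('a, 'm) pas_scheme \<Rightarrow> ('b, 'n) pas_scheme \<Rightarrow> ('a \<times> 'b) set \<Rightarrow> bool" where
  "applicative_isomorphism A B \<gamma> \<longleftrightarrow>
     applicative_morphism A B \<gamma> \<and>
     (\<exists>\<delta>. applicative_morphism B A \<delta> \<and>
          \<gamma> O \<delta> = Id_on (carrier A) \<and> \<delta> O \<gamma> = Id_on (carrier B))"


section \<open>Kleene's second model and its binary variant\<close>

text \<open>\<open>seq_code n \<beta> k\<close> is the code \<open>[n, \<beta>(0), \<dots>, \<beta>(k - 1)]\<close>; the coding of finite
  sequences is the bijection \<^const>\<open>list_encode\<close>.\<close>

definition seq_code :: "nat \<Rightarrow> (nat \<Rightarrow> nat) \<Rightarrow> nat \<Rightarrow> nat" where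
  "seq_code n \<beta> k = list_encode (n # map \<beta> [0..<k])"

definition kleene_second :: "(nat \<Rightarrow> nat) pas" where
  "kleene_second =
     \<lparr> carrier = UNIV,
       app = (\<lambda>\<alpha> \<beta>.
         if \<forall>n. \<exists>k. \<alpha> (seq_code n \<beta> k) > 0
         then Some (\<lambda>n. \<alpha> (seq_code n \<beta> (LEAST k. \<alpha> (seq_code n \<beta> k) > 0)) - 1)
         else None) \<rparr>"

text \<open>The output of the binary model is read off one position after the first \<open>1\<close>, at
  \<open>[n, \<beta>(0), \<dots>, \<beta>(k)]\<close>.\<close>

definition two_omega :: "(nat \<Rightarrow> nat) pas" where
  "two_omega =
     \<lparr> carrier = {\<alpha>. \<forall>n. \<alpha> n \<in> {0, 1}},
       app = (\<lambda>\<alpha> \<beta>.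
         if \<forall>n. \<exists>k. \<alpha> (seq_code n \<beta> k) = 1
         then Some (\<lambda>n. \<alpha> (seq_code n \<beta> (Suc (LEAST k. \<alpha> (seq_code n \<beta> k) = 1))))
         else None) \<rparr>"


section \<open>Both models are partial combinatory algebras\<close>

definition agree :: "nat \<Rightarrow> (nat \<Rightarrow> nat) \<Rightarrow> (nat \<Rightarrow> nat) \<Rightarrow> bool" where
  "agree K \<alpha> \<beta> \<longleftrightarrow> (\<forall>i<K. \<alpha> i = \<beta> i)"

lemma agree_refl [simp]: "agree K \<alpha> \<alpha>"
  by (simp add: agree_def)

lemma agree_mono: "agree K \<alpha> \<beta> \<Longrightarrow> L \<le> K \<Longrightarrow> agree L \<alpha> \<beta>"
  by (simp add: agree_def)

lemma agrees_refl [simp]: "list_all2 (agree K) ps ps"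
  by (simp add: list_all2_refl)

lemma agrees_mono: "list_all2 (agree K) ps qs \<Longrightarrow> L \<le> K \<Longrightarrow> list_all2 (agree L) ps qs"
  by (erule list_all2_mono) (auto intro: agree_mono)

lemma agrees_sym: "list_all2 (agree K) ps qs \<Longrightarrow> list_all2 (agree K) qs ps"
  by (auto simp: list_all2_conv_all_nth agree_def)

lemma agrees_trans:
  "list_all2 (agree K) ps qs \<Longrightarrow> list_all2 (agree K) qs rs \<Longrightarrow> list_all2 (agree K) ps rs"
  by (auto simp: list_all2_conv_all_nth agree_def)

lemma agree_map: "agree K \<alpha> \<beta> \<longleftrightarrow> map \<alpha> [0..<K] = map \<beta> [0..<K]"
  by (auto simp: agree_def)

lemma seq_code_agree: "agree K \<beta> \<beta>' \<Longrightarrow> k \<le> K \<Longrightarrow> seq_code n \<beta> k = seq_code n \<beta>' k"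
  by (auto simp: agree_def seq_code_def intro!: arg_cong[of _ _ list_encode])

text \<open>\<open>ev \<alpha> \<beta> n v\<close> says that the computation of \<open>(\<alpha>\<beta>)(n)\<close> converges to \<open>v\<close>, whether or not
  \<open>\<alpha>\<beta>\<close> is defined at other arguments; \<open>code D\<close> is an element that answers \<open>D n u\<close> on input
  \<open>n\<close> as soon as an initial segment \<open>u\<close> of its argument with \<open>D n u \<noteq> None\<close> has been read.\<close>

locale sequence_model =
  fixes A :: "(nat \<Rightarrow> nat) pas" and V :: "nat set"
    and ev :: "(nat \<Rightarrow> nat) \<Rightarrow> (nat \<Rightarrow> nat) \<Rightarrow> nat \<Rightarrow> nat \<Rightarrow> bool"
    and code :: "(nat \<Rightarrow> nat list \<Rightarrow> nat option) \<Rightarrow> nat \<Rightarrow> nat"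
  assumes carrier_eq: "carrier A = {\<alpha>. \<forall>n. \<alpha> n \<in> V}"
    and app_iff: "app A \<alpha> \<beta> = Some \<gamma> \<longleftrightarrow> (\<forall>n. ev \<alpha> \<beta> n (\<gamma> n))"
    and ev_fun: "ev \<alpha> \<beta> n v \<Longrightarrow> ev \<alpha> \<beta> n w \<Longrightarrow> v = w"
    and ev_V: "\<alpha> \<in> carrier A \<Longrightarrow> ev \<alpha> \<beta> n v \<Longrightarrow> v \<in> V"
    and ev_open: "ev \<alpha> \<beta> n v \<Longrightarrow>
      \<exists>K. \<forall>\<alpha>' \<beta>'. agree K \<alpha> \<alpha>' \<longrightarrow> agree K \<beta> \<beta>' \<longrightarrow> ev \<alpha>' \<beta>' n v"
    and code_carrier: "(\<And>n u v. D n u = Some v \<Longrightarrow> v \<in> V) \<Longrightarrow> code D \<in> carrier A"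
    and code_ev: "D n (map \<beta> [0..<k]) \<noteq> None \<Longrightarrow>
      (\<And>k v. D n (map \<beta> [0..<k]) = Some v \<Longrightarrow> v = w) \<Longrightarrow> ev (code D) \<beta> n w"
    and code_local: "\<exists>L. \<forall>D D'. (\<forall>n u. length u \<le> L \<longrightarrow> D n u = D' n u) \<longrightarrow>
      code D m = code D' m"
begin

abbreviation "C \<equiv> carrier A"

definition sound :: "nat \<Rightarrow> ((nat \<Rightarrow> nat) list \<Rightarrow> nat \<Rightarrow> nat \<Rightarrow> bool) \<Rightarrow> bool" where
  "sound l P \<longleftrightarrow> (\<forall>ps n v. length ps = l \<longrightarrow> set ps \<subseteq> C \<longrightarrow> P ps n v \<longrightarrow>
     v \<in> V \<and> (\<forall>w. P ps n w \<longrightarrow> w = v) \<and>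
     (\<exists>K. \<forall>qs. set qs \<subseteq> C \<longrightarrow> list_all2 (agree K) ps qs \<longrightarrow> P qs n v))"

lemma soundD:
  assumes "sound l P" "length ps = l" "set ps \<subseteq> C" "P ps n v"
  shows "v \<in> V" and "P ps n w \<Longrightarrow> w = v"
    and "\<exists>K. \<forall>qs. set qs \<subseteq> C \<longrightarrow> list_all2 (agree K) ps qs \<longrightarrow> P qs n v"
  using assms(1)[unfolded sound_def, rule_format, OF assms(2-4)] by simp_all

definition forced :: "((nat \<Rightarrow> nat) list \<Rightarrow> nat \<Rightarrow> nat \<Rightarrow> bool) \<Rightarrow> (nat \<Rightarrow> nat) list \<Rightarrow>
    nat \<Rightarrow> nat list \<Rightarrow> nat \<Rightarrow> bool" where
  "forced P ps n u v \<longleftrightarrow> v \<in> V \<and>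
     (\<forall>qs \<beta>. set qs \<subseteq> C \<longrightarrow> \<beta> \<in> C \<longrightarrow> list_all2 (agree (length u)) ps qs \<longrightarrow>
        map \<beta> [0..<length u] = u \<longrightarrow> P (qs @ [\<beta>]) n v)"

definition decide :: "((nat \<Rightarrow> nat) list \<Rightarrow> nat \<Rightarrow> nat \<Rightarrow> bool) \<Rightarrow> (nat \<Rightarrow> nat) list \<Rightarrow>
    nat \<Rightarrow> nat list \<Rightarrow> nat option" where
  "decide P ps n u =
     (if \<exists>v. forced P ps n u v then Some (SOME v. forced P ps n u v) else None)"

definition cur :: "((nat \<Rightarrow> nat) list \<Rightarrow> nat \<Rightarrow> nat \<Rightarrow> bool) \<Rightarrow> (nat \<Rightarrow> nat) list \<Rightarrow> nat \<Rightarrow> nat"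
  where "cur P ps = code (decide P ps)"

abbreviation graph :: "((nat \<Rightarrow> nat) list \<Rightarrow> nat \<Rightarrow> nat) \<Rightarrow> (nat \<Rightarrow> nat) list \<Rightarrow> nat \<Rightarrow> nat \<Rightarrow> bool"
  where "graph F \<equiv> \<lambda>ps n v. F ps n = v"

lemma decide_forced: "decide P ps n u = Some v \<Longrightarrow> forced P ps n u v"
  by (auto simp: decide_def split: if_splits intro: someI)

lemma cur_carrier: "cur P ps \<in> C"
  unfolding cur_def by (rule code_carrier) (auto dest: decide_forced simp: forced_def)

lemma cur_app:
  assumes P: "sound (Suc (length ps)) P" and C: "set ps \<subseteq> C" "\<beta> \<in> C"
    and v: "\<And>n. P (ps @ [\<beta>]) n (\<gamma> n)"
  shows "app A (cur P ps) \<beta> = Some \<gamma>"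
  unfolding app_iff
proof
  fix n
  have l: "length (ps @ [\<beta>]) = Suc (length ps)" "set (ps @ [\<beta>]) \<subseteq> C" using C by auto
  note D = soundD[OF P l v[of n]]
  have V: "\<gamma> n \<in> V" and uniq: "\<And>w. P (ps @ [\<beta>]) n w \<Longrightarrow> w = \<gamma> n" by (fact D(1), rule D(2))
  obtain K where
    K: "\<And>qs. set qs \<subseteq> C \<Longrightarrow> list_all2 (agree K) (ps @ [\<beta>]) qs \<Longrightarrow> P qs n (\<gamma> n)"
    using D(3) by blast
  have "forced P ps n (map \<beta> [0..<K]) (\<gamma> n)"
    unfolding forced_def
  proof (intro conjI allI impI V)
    fix qs \<beta>'
    assume *: "set qs \<subseteq> C" "\<beta>' \<in> C" "list_all2 (agree (length (map \<beta> [0..<K]))) ps qs"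
      "map \<beta>' [0..<length (map \<beta> [0..<K])] = map \<beta> [0..<K]"
    then have "agree K \<beta> \<beta>'" by (simp add: agree_def)
    with * show "P (qs @ [\<beta>']) n (\<gamma> n)"
      by (intro K) (auto intro!: list_all2_appendI)
  qed
  then have 1: "decide P ps n (map \<beta> [0..<K]) \<noteq> None"
    by (auto simp: decide_def)
  have 2: "v = \<gamma> n" if "decide P ps n (map \<beta> [0..<k]) = Some v" for k v
    using decide_forced[OF that] C by (intro uniq) (auto simp: forced_def)
  show "ev (cur P ps) \<beta> n (\<gamma> n)"
    unfolding cur_def using 1 2 by (rule code_ev)
qed

lemma forced_agree:
  assumes "list_all2 (agree (length u)) ps qs" "forced P ps n u v"
  shows "forced P qs n u v"
  using assms(2) unfolding forced_def
  by (auto dest: agrees_trans[OF assms(1)])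

lemma decide_agree:
  assumes "list_all2 (agree (length u)) ps qs"
  shows "decide P ps n u = decide P qs n u"
proof -
  have "forced P ps n u = forced P qs n u"
    using forced_agree[OF assms] forced_agree[OF agrees_sym[OF assms]] by blast
  then show ?thesis by (simp add: decide_def)
qed

lemma sound_cur: "sound l (graph (cur P))"
  unfolding sound_def
proof (intro allI impI conjI)
  fix ps n v assume eq: "cur P ps n = v"
  show "v \<in> V" using cur_carrier[of P ps] eq by (auto simp: carrier_eq)
  show "w = v" if "cur P ps n = w" for w using eq that by simp
  obtain L where L: "\<And>D D'. (\<And>n u. length u \<le> L \<Longrightarrow> D n u = D' n u) \<Longrightarrow>
      code D n = code D' n"
    using code_local[of n] by blast
  show "\<exists>K. \<forall>qs. set qs \<subseteq> C \<longrightarrow> list_all2 (agree K) ps qs \<longrightarrow> cur P qs n = v"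
  proof (intro exI[of _ L] allI impI)
    fix qs assume "list_all2 (agree L) ps qs"
    note a = this
    have "code (decide P ps) n = code (decide P qs) n"
      by (rule L, rule decide_agree, rule agrees_mono[OF a])
    with eq show "cur P qs n = v" by (simp add: cur_def)
  qed
qed

definition s_spec :: "(nat \<Rightarrow> nat) list \<Rightarrow> nat \<Rightarrow> nat \<Rightarrow> bool" where
  "s_spec ps n v \<longleftrightarrow> (\<exists>K \<xi> \<eta>. \<xi> \<in> C \<and> \<eta> \<in> C \<and>
     (\<forall>i<K. ev (ps ! 0) (ps ! 2) i (\<xi> i)) \<and> (\<forall>i<K. ev (ps ! 1) (ps ! 2) i (\<eta> i)) \<and>
     (\<forall>\<xi>' \<eta>'. agree K \<xi> \<xi>' \<longrightarrow> agree K \<eta> \<eta>' \<longrightarrow> ev \<xi>' \<eta>' n v))"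

lemma s_spec_fun:
  assumes "s_spec ps n v" "s_spec ps n w" shows "v = w"
proof -
  obtain K \<xi> \<eta> where 1: "\<forall>i<K. ev (ps ! 0) (ps ! 2) i (\<xi> i)" "\<forall>i<K. ev (ps ! 1) (ps ! 2) i (\<eta> i)"
     "\<And>\<xi>' \<eta>'. agree K \<xi> \<xi>' \<Longrightarrow> agree K \<eta> \<eta>' \<Longrightarrow> ev \<xi>' \<eta>' n v"
    using assms(1) unfolding s_spec_def by blast
  obtain L \<phi> \<psi> where 2: "\<forall>i<L. ev (ps ! 0) (ps ! 2) i (\<phi> i)" "\<forall>i<L. ev (ps ! 1) (ps ! 2) i (\<psi> i)"
     "\<And>\<xi>' \<eta>'. agree L \<phi> \<xi>' \<Longrightarrow> agree L \<psi> \<eta>' \<Longrightarrow> ev \<xi>' \<eta>' n w"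
    using assms(2) unfolding s_spec_def by blast
  show ?thesis
  proof (cases "K \<le> L")
    case True
    then have "agree K \<xi> \<phi>" "agree K \<eta> \<psi>" using 1 2 ev_fun by (auto simp: agree_def)
    from 1(3)[OF this] 2(3)[of \<phi> \<psi>] show ?thesis using ev_fun by auto
  next
    case False
    then have "agree L \<phi> \<xi>" "agree L \<psi> \<eta>" using 1(1,2) 2(1,2) ev_fun by (auto simp: agree_def)
    from 2(3)[OF this] 1(3)[of \<xi> \<eta>] show ?thesis using ev_fun by auto
  qed
qed

lemma ev_open_upto:
  fixes K :: nat
  assumes "\<forall>i<K. ev \<alpha> \<beta> i (\<xi> i)"
  shows "\<exists>M. \<forall>\<alpha>' \<beta>'. agree M \<alpha> \<alpha>' \<longrightarrow> agree M \<beta> \<beta>' \<longrightarrow> (\<forall>i<K. ev \<alpha>' \<beta>' i (\<xi> i))"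
  using assms
proof (induction K)
  case 0
  show ?case by simp
next
  case (Suc K)
  then obtain M where M:
    "\<And>\<alpha>' \<beta>'. agree M \<alpha> \<alpha>' \<Longrightarrow> agree M \<beta> \<beta>' \<Longrightarrow> \<forall>i<K. ev \<alpha>' \<beta>' i (\<xi> i)"
    by (metis less_Suc_eq)
  from Suc.prems have "ev \<alpha> \<beta> K (\<xi> K)" by simp
  from ev_open[OF this] obtain N where N:
    "\<And>\<alpha>' \<beta>'. agree N \<alpha> \<alpha>' \<Longrightarrow> agree N \<beta> \<beta>' \<Longrightarrow> ev \<alpha>' \<beta>' K (\<xi> K)"
    by blast
  show ?case
  proof (intro exI[of _ "max M N"] allI impI)
    fix \<alpha>' \<beta>' i assume a: "agree (max M N) \<alpha> \<alpha>'" "agree (max M N) \<beta> \<beta>'" and "i < Suc K"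
    have "agree M \<alpha> \<alpha>'" "agree M \<beta> \<beta>'" "agree N \<alpha> \<alpha>'" "agree N \<beta> \<beta>'"
      by (rule agree_mono[OF a(1)] agree_mono[OF a(2)]; simp)+
    with M N \<open>i < Suc K\<close> show "ev \<alpha>' \<beta>' i (\<xi> i)" by (metis less_Suc_eq)
  qed
qed

lemma sound_s_spec: "sound 3 s_spec"
  unfolding sound_def
proof (intro allI impI conjI)
  fix ps n v assume len: "length ps = (3::nat)" and C: "set ps \<subseteq> C" and v: "s_spec ps n v"
  show "w = v" if "s_spec ps n w" for w using s_spec_fun[OF that v] .
  obtain K \<xi> \<eta> where *: "\<xi> \<in> C" "\<eta> \<in> C" "\<forall>i<K. ev (ps ! 0) (ps ! 2) i (\<xi> i)"
     "\<forall>i<K. ev (ps ! 1) (ps ! 2) i (\<eta> i)"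
     "\<And>\<xi>' \<eta>'. agree K \<xi> \<xi>' \<Longrightarrow> agree K \<eta> \<eta>' \<Longrightarrow> ev \<xi>' \<eta>' n v"
    using v unfolding s_spec_def by blast
  show "v \<in> V" using ev_V[OF *(1) *(5)[OF agree_refl agree_refl]] .
  from ev_open_upto[OF *(3)] obtain M where M: "\<And>\<alpha>' \<beta>'. agree M (ps ! 0) \<alpha>' \<Longrightarrow>
    agree M (ps ! 2) \<beta>' \<Longrightarrow> \<forall>i<K. ev \<alpha>' \<beta>' i (\<xi> i)" by blast
  from ev_open_upto[OF *(4)] obtain N where N: "\<And>\<alpha>' \<beta>'. agree N (ps ! 1) \<alpha>' \<Longrightarrow>
    agree N (ps ! 2) \<beta>' \<Longrightarrow> \<forall>i<K. ev \<alpha>' \<beta>' i (\<eta> i)" by blast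
  show "\<exists>K. \<forall>qs. set qs \<subseteq> C \<longrightarrow> list_all2 (agree K) ps qs \<longrightarrow> s_spec qs n v"
  proof (intro exI[of _ "max M N"] allI impI)
    fix qs assume "list_all2 (agree (max M N)) ps qs"
    then have a: "agree (max M N) (ps ! i) (qs ! i)" if "i < 3" for i
      using that len by (auto simp: list_all2_conv_all_nth)
    have "agree M (ps ! i) (qs ! i)" "agree N (ps ! i) (qs ! i)" if "i < 3" for i
      by (rule agree_mono[OF a[OF that]]; simp)+
    then have "\<forall>i<K. ev (qs ! 0) (qs ! 2) i (\<xi> i)" "\<forall>i<K. ev (qs ! 1) (qs ! 2) i (\<eta> i)"
      by (auto intro!: M[rule_format] N[rule_format])
    with * show "s_spec qs n v" unfolding s_spec_def by blast
  qed
qed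

lemma app_carrier: "\<alpha> \<in> C \<Longrightarrow> app A \<alpha> \<beta> = Some \<gamma> \<Longrightarrow> \<gamma> \<in> C"
  using ev_V unfolding app_iff carrier_eq by blast

lemma s_spec_app:
  assumes "\<alpha> \<in> C" "\<beta> \<in> C" "app A \<alpha> \<gamma> = Some \<xi>" "app A \<beta> \<gamma> = Some \<eta>" "app A \<xi> \<eta> = Some \<delta>"
  shows "s_spec [\<alpha>, \<beta>, \<gamma>] n (\<delta> n)"
proof -
  have "\<xi> \<in> C" "\<eta> \<in> C" using app_carrier assms by auto
  moreover from assms(5) have "ev \<xi> \<eta> n (\<delta> n)" by (simp add: app_iff)
  from ev_open[OF this] obtain K where
    "\<forall>\<alpha>' \<beta>'. agree K \<xi> \<alpha>' \<longrightarrow> agree K \<eta> \<beta>' \<longrightarrow> ev \<alpha>' \<beta>' n (\<delta> n)" by blast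
  ultimately show ?thesis
    using assms unfolding s_spec_def app_iff by (intro exI[of _ K] exI[of _ \<xi>] exI[of _ \<eta>]) simp
qed

lemma sound_fst: "sound 2 (\<lambda>ps n v. (ps ! 0) n = v)"
  unfolding sound_def
proof (intro allI impI conjI)
  fix ps n v assume len: "length ps = (2::nat)" and C: "set ps \<subseteq> C" and v: "(ps ! 0) n = v"
  have "ps ! 0 \<in> C" using len C by (auto simp: subset_iff)
  then show "v \<in> V" using v by (auto simp: carrier_eq)
  show "w = v" if "(ps ! 0) n = w" for w using v that by simp
  show "\<exists>K. \<forall>qs. set qs \<subseteq> C \<longrightarrow> list_all2 (agree K) ps qs \<longrightarrow> (qs ! 0) n = v"
    using len v by (intro exI[of _ "Suc n"]) (auto simp: list_all2_conv_all_nth agree_def)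
qed

theorem pca: "pca A"
proof -
  define k1 where "k1 = cur (\<lambda>ps n v. (ps ! 0) n = v)"
  define k where "k = cur (graph k1) []"
  define s2 where "s2 = cur s_spec"
  define s1 where "s1 = cur (graph s2)"
  define s where "s = cur (graph s1) []"
  have kC: "k \<in> C" and sC: "s \<in> C" by (simp_all add: k_def s_def cur_carrier)
  have k: "app A k \<alpha> = Some (k1 [\<alpha>])" if "\<alpha> \<in> C" for \<alpha>
    unfolding k_def using that by (intro cur_app) (auto simp: k1_def intro: sound_cur)
  have k1: "app A (k1 [\<alpha>]) \<beta> = Some \<alpha>" if "\<alpha> \<in> C" "\<beta> \<in> C" for \<alpha> \<beta>
    unfolding k1_def using that sound_fst by (intro cur_app) (auto simp: numeral_2_eq_2)
  have s: "app A s \<alpha> = Some (s1 [\<alpha>])" if "\<alpha> \<in> C" for \<alpha>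
    unfolding s_def using that by (intro cur_app) (auto simp: s1_def intro: sound_cur)
  have s1: "app A (s1 [\<alpha>]) \<beta> = Some (s2 [\<alpha>, \<beta>])" if "\<alpha> \<in> C" "\<beta> \<in> C" for \<alpha> \<beta>
    unfolding s1_def using that by (intro cur_app) (auto simp: s2_def intro: sound_cur)
  have s2: "app A (s2 [\<alpha>, \<beta>]) \<gamma> = Some \<delta>"
    if "\<alpha> \<in> C" "\<beta> \<in> C" "\<gamma> \<in> C"
      "app A \<alpha> \<gamma> = Some \<xi>" "app A \<beta> \<gamma> = Some \<eta>" "app A \<xi> \<eta> = Some \<delta>" for \<alpha> \<beta> \<gamma> \<xi> \<eta> \<delta>
    unfolding s2_def using that sound_s_spec s_spec_app
    by (intro cur_app) (auto simp: numeral_3_eq_3)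
  show ?thesis
    unfolding pca_def
    by (intro conjI bexI[OF _ kC] bexI[OF _ sC] ballI allI impI)
      (auto simp: papp_def k k1 s s1 s2 bind_eq_Some_conv intro: app_carrier)
qed

end

definition kleene_ev :: "(nat \<Rightarrow> nat) \<Rightarrow> (nat \<Rightarrow> nat) \<Rightarrow> nat \<Rightarrow> nat \<Rightarrow> bool" where
  "kleene_ev \<alpha> \<beta> n v \<longleftrightarrow>
     (\<exists>k. \<alpha> (seq_code n \<beta> k) = Suc v \<and> (\<forall>j<k. \<alpha> (seq_code n \<beta> j) = 0))"

definition kleene_code :: "(nat \<Rightarrow> nat list \<Rightarrow> nat option) \<Rightarrow> nat \<Rightarrow> nat" where
  "kleene_code D m = (case list_decode m of [] \<Rightarrow> 0
     | n # u \<Rightarrow> (case D n u of None \<Rightarrow> 0 | Some v \<Rightarrow> Suc v))"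

definition two_ev :: "(nat \<Rightarrow> nat) \<Rightarrow> (nat \<Rightarrow> nat) \<Rightarrow> nat \<Rightarrow> nat \<Rightarrow> bool" where
  "two_ev \<alpha> \<beta> n v \<longleftrightarrow>
     (\<exists>k. \<alpha> (seq_code n \<beta> k) = 1 \<and> (\<forall>j<k. \<alpha> (seq_code n \<beta> j) \<noteq> 1) \<and>
       \<alpha> (seq_code n \<beta> (Suc k)) = v)"

definition two_code :: "(nat \<Rightarrow> nat list \<Rightarrow> nat option) \<Rightarrow> nat \<Rightarrow> nat" where
  "two_code D m = (case list_decode m of [] \<Rightarrow> 0
     | n # u \<Rightarrow> (if u \<noteq> [] \<and> D n (butlast u) \<noteq> None then the (D n (butlast u))
                 else if D n u \<noteq> None then 1 else 0))"

lemma ex_common_bound: "\<exists>K. k \<le> K \<and> (\<forall>j\<le>k. seq_code n \<beta> j < K)"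
proof -
  let ?M = "Max (seq_code n \<beta> ` {..k})"
  have "seq_code n \<beta> j < k + Suc ?M" if "j \<le> k" for j
    using Max_ge[of "seq_code n \<beta> ` {..k}" "seq_code n \<beta> j"] that
    by (simp add: less_Suc_eq_le trans_le_add2)
  then show ?thesis by (intro exI[of _ "k + Suc ?M"]) auto
qed

lemma ex_modulus:
  "\<exists>K. \<forall>\<alpha>' \<beta>'. agree K \<alpha> \<alpha>' \<longrightarrow> agree K \<beta> \<beta>' \<longrightarrow>
     (\<forall>j\<le>k. \<alpha>' (seq_code n \<beta>' j) = \<alpha> (seq_code n \<beta> j))"
proof -
  obtain K where K: "k \<le> K" "\<And>j. j \<le> k \<Longrightarrow> seq_code n \<beta> j < K"
    using ex_common_bound by blast
  show ?thesis
  proof (intro exI[of _ K] allI impI)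
    fix \<alpha>' \<beta>' j assume a: "agree K \<alpha> \<alpha>'" "agree K \<beta> \<beta>'" and j: "j \<le> k"
    have "seq_code n \<beta> j = seq_code n \<beta>' j"
      using seq_code_agree[OF a(2)] j K(1) by simp
    with K(2)[OF j] a(1) show "\<alpha>' (seq_code n \<beta>' j) = \<alpha> (seq_code n \<beta> j)"
      by (simp add: agree_def)
  qed
qed

lemma if_Some_iff:
  assumes "\<And>n v. E n v \<longleftrightarrow> P n \<and> F n = v"
  shows "(if \<forall>n. P n then Some F else None) = Some \<gamma> \<longleftrightarrow> (\<forall>n. E n (\<gamma> n))"
proof (cases "\<forall>n. P n")
  case True
  then have "(if \<forall>n. P n then Some F else None) = Some \<gamma> \<longleftrightarrow> F = \<gamma>" by simp
  with True show ?thesis unfolding assms fun_eq_iff by blast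
next
  case False
  then have "(if \<forall>n. P n then Some F else None) \<noteq> Some \<gamma>" by auto
  with False show ?thesis unfolding assms by blast
qed

lemma Least_first:
  fixes Q :: "nat \<Rightarrow> bool"
  assumes "Q k" "\<And>j. j < k \<Longrightarrow> \<not> Q j"
  shows "(LEAST k. Q k) = k"
  using assms(1) by (rule Least_equality) (use assms(2) in \<open>blast intro: leI\<close>)

lemma kleene_ev_iff:
  "kleene_ev \<alpha> \<beta> n v \<longleftrightarrow> (\<exists>k. \<alpha> (seq_code n \<beta> k) > 0) \<and>
     \<alpha> (seq_code n \<beta> (LEAST k. \<alpha> (seq_code n \<beta> k) > 0)) - 1 = v"
proof -
  define Q where "Q k \<longleftrightarrow> \<alpha> (seq_code n \<beta> k) > 0" for k
  have "kleene_ev \<alpha> \<beta> n v \<longleftrightarrow> (\<exists>k. Q k \<and> (\<forall>j<k. \<not> Q j) \<and> \<alpha> (seq_code n \<beta> k) - 1 = v)"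
    unfolding kleene_ev_def Q_def by (intro ex_cong1) auto
  also have "\<dots> \<longleftrightarrow> (\<exists>k. Q k) \<and> \<alpha> (seq_code n \<beta> (Least Q)) - 1 = v"
    using LeastI_ex[of Q] not_less_Least[of _ Q] Least_first[of Q] by metis
  finally show ?thesis unfolding Q_def .
qed

lemma two_ev_iff:
  "two_ev \<alpha> \<beta> n v \<longleftrightarrow> (\<exists>k. \<alpha> (seq_code n \<beta> k) = 1) \<and>
     \<alpha> (seq_code n \<beta> (Suc (LEAST k. \<alpha> (seq_code n \<beta> k) = 1))) = v"
proof -
  define Q where "Q k \<longleftrightarrow> \<alpha> (seq_code n \<beta> k) = 1" for k
  have "two_ev \<alpha> \<beta> n v \<longleftrightarrow> (\<exists>k. Q k \<and> (\<forall>j<k. \<not> Q j) \<and> \<alpha> (seq_code n \<beta> (Suc k)) = v)"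
    unfolding two_ev_def Q_def by simp
  also have "\<dots> \<longleftrightarrow> (\<exists>k. Q k) \<and> \<alpha> (seq_code n \<beta> (Suc (Least Q))) = v"
    using LeastI_ex[of Q] not_less_Least[of _ Q] Least_first[of Q] by metis
  finally show ?thesis unfolding Q_def .
qed

lemma first_index:
  fixes Q :: "nat \<Rightarrow> bool"
  assumes "Q k"
  obtains m where "Q m" "\<And>j. j < m \<Longrightarrow> \<not> Q j"
  using LeastI[of Q, OF assms] not_less_Least[of _ Q] by (rule that)

lemma butlast_prefix: "butlast (map \<beta> [0..<k]) = map \<beta> [0..<k - 1]"
  by (cases k) auto

lemma kleene_code_local:
  assumes "\<forall>n u. length u \<le> length (list_decode m) \<longrightarrow> D n u = D' n u"
  shows "kleene_code D m = kleene_code D' m"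
  using assms by (auto simp: kleene_code_def split: list.split)

lemma two_code_local:
  assumes "\<forall>n u. length u \<le> length (list_decode m) \<longrightarrow> D n u = D' n u"
  shows "two_code D m = two_code D' m"
  using assms by (auto simp: two_code_def split: list.split)

interpretation kleene: sequence_model kleene_second UNIV kleene_ev kleene_code
proof
  show "carrier kleene_second = {\<alpha>. \<forall>n. \<alpha> n \<in> UNIV}" by (simp add: kleene_second_def)
  show "app kleene_second \<alpha> \<beta> = Some \<gamma> \<longleftrightarrow> (\<forall>n. kleene_ev \<alpha> \<beta> n (\<gamma> n))" for \<alpha> \<beta> \<gamma>
    unfolding kleene_second_def pas.simps by (rule if_Some_iff) (rule kleene_ev_iff)
  show "v = w" if "kleene_ev \<alpha> \<beta> n v" "kleene_ev \<alpha> \<beta> n w" for \<alpha> \<beta> n v w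
    using that by (auto simp: kleene_ev_iff)
  show "v \<in> UNIV" for v :: nat by simp
  show "kleene_code D \<in> carrier kleene_second" for D by (simp add: kleene_second_def)
  show "\<exists>K. \<forall>\<alpha>' \<beta>'. agree K \<alpha> \<alpha>' \<longrightarrow> agree K \<beta> \<beta>' \<longrightarrow> kleene_ev \<alpha>' \<beta>' n v"
    if e: "kleene_ev \<alpha> \<beta> n v" for \<alpha> \<beta> n v
  proof -
    obtain k where k: "\<alpha> (seq_code n \<beta> k) = Suc v" "\<forall>j<k. \<alpha> (seq_code n \<beta> j) = 0"
      using e by (auto simp: kleene_ev_def)
    obtain K where K: "\<And>\<alpha>' \<beta>' j. agree K \<alpha> \<alpha>' \<Longrightarrow> agree K \<beta> \<beta>' \<Longrightarrow> j \<le> k \<Longrightarrow>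
        \<alpha>' (seq_code n \<beta>' j) = \<alpha> (seq_code n \<beta> j)"
      using ex_modulus[of \<alpha> \<beta> k n] by blast
    show ?thesis
      unfolding kleene_ev_def using k K
      by (intro exI[of _ K] allI impI exI[of _ k]) auto
  qed
  show "kleene_ev (kleene_code D) \<beta> n w"
    if D: "D n (map \<beta> [0..<k]) \<noteq> None"
      and w: "\<And>k v. D n (map \<beta> [0..<k]) = Some v \<Longrightarrow> v = w" for D n \<beta> k w
  proof -
    have code: "kleene_code D (seq_code n \<beta> j) =
        (case D n (map \<beta> [0..<j]) of None \<Rightarrow> 0 | Some v \<Rightarrow> Suc v)" for j
      by (simp add: kleene_code_def seq_code_def)
    obtain m where m: "D n (map \<beta> [0..<m]) \<noteq> None"
      "\<And>j. j < m \<Longrightarrow> \<not> D n (map \<beta> [0..<j]) \<noteq> None"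
      using first_index[of "\<lambda>k. D n (map \<beta> [0..<k]) \<noteq> None", OF D] by blast
    then show ?thesis
      unfolding kleene_ev_def code using w by (intro exI[of _ m]) auto
  qed
  show "\<exists>L. \<forall>D D'. (\<forall>n u. length u \<le> L \<longrightarrow> D n u = D' n u) \<longrightarrow> kleene_code D m = kleene_code D' m"
    for m
    using kleene_code_local by blast
qed

interpretation two: sequence_model two_omega "{0, 1}" two_ev two_code
proof
  show "carrier two_omega = {\<alpha>. \<forall>n. \<alpha> n \<in> {0, 1}}" by (simp add: two_omega_def)
  show "app two_omega \<alpha> \<beta> = Some \<gamma> \<longleftrightarrow> (\<forall>n. two_ev \<alpha> \<beta> n (\<gamma> n))" for \<alpha> \<beta> \<gamma>
    unfolding two_omega_def pas.simps by (rule if_Some_iff) (rule two_ev_iff)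
  show "v = w" if "two_ev \<alpha> \<beta> n v" "two_ev \<alpha> \<beta> n w" for \<alpha> \<beta> n v w
    using that by (auto simp: two_ev_iff)
  show "v \<in> {0, 1}" if "\<alpha> \<in> carrier two_omega" "two_ev \<alpha> \<beta> n v" for \<alpha> \<beta> n v
  proof -
    from that(2) obtain m where "\<alpha> m = v" unfolding two_ev_def by blast
    with that(1) show ?thesis unfolding two_omega_def by (simp, metis)
  qed
  show "two_code D \<in> carrier two_omega" if D: "\<And>n u v. D n u = Some v \<Longrightarrow> v \<in> {0, 1}" for D
  proof -
    have 1: "the (D n u) \<in> {0, 1}" if "D n u \<noteq> None" for n u
      using that D by (metis option.exhaust_sel)
    have "two_code D m \<in> {0, 1}" for m
      using 1 by (cases "list_decode m") (simp_all add: two_code_def)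
    then show ?thesis by (simp add: two_omega_def)
  qed
  show "\<exists>K. \<forall>\<alpha>' \<beta>'. agree K \<alpha> \<alpha>' \<longrightarrow> agree K \<beta> \<beta>' \<longrightarrow> two_ev \<alpha>' \<beta>' n v"
    if e: "two_ev \<alpha> \<beta> n v" for \<alpha> \<beta> n v
  proof -
    obtain k where k: "\<alpha> (seq_code n \<beta> k) = 1" "\<forall>j<k. \<alpha> (seq_code n \<beta> j) \<noteq> 1"
        "\<alpha> (seq_code n \<beta> (Suc k)) = v"
      using e by (auto simp: two_ev_def)
    obtain K where K: "\<And>\<alpha>' \<beta>' j. agree K \<alpha> \<alpha>' \<Longrightarrow> agree K \<beta> \<beta>' \<Longrightarrow> j \<le> Suc k \<Longrightarrow>
        \<alpha>' (seq_code n \<beta>' j) = \<alpha> (seq_code n \<beta> j)"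
      using ex_modulus[of \<alpha> \<beta> "Suc k" n] by blast
    show ?thesis
    proof (intro exI[of _ K] allI impI)
      fix \<alpha>' \<beta>' assume "agree K \<alpha> \<alpha>'" "agree K \<beta> \<beta>'"
      note eq = K[OF this]
      show "two_ev \<alpha>' \<beta>' n v"
        unfolding two_ev_def
      proof (intro exI[of _ k] conjI allI impI)
        show "\<alpha>' (seq_code n \<beta>' k) = 1" using eq[of k] k(1) by simp
        show "\<alpha>' (seq_code n \<beta>' j) \<noteq> 1" if "j < k" for j using eq[of j] k(2) that by simp
        show "\<alpha>' (seq_code n \<beta>' (Suc k)) = v" using eq[of "Suc k"] k(3) by simp
      qed
    qed
  qed
  show "two_ev (two_code D) \<beta> n w"
    if D: "D n (map \<beta> [0..<k]) \<noteq> None"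
      and w: "\<And>k v. D n (map \<beta> [0..<k]) = Some v \<Longrightarrow> v = w" for D n \<beta> k w
  proof -
    have code: "two_code D (seq_code n \<beta> j) =
        (if j \<noteq> 0 \<and> D n (map \<beta> [0..<j - 1]) \<noteq> None then the (D n (map \<beta> [0..<j - 1]))
         else if D n (map \<beta> [0..<j]) \<noteq> None then 1 else 0)" for j
      by (simp add: two_code_def seq_code_def butlast_prefix)
    obtain m where m1: "D n (map \<beta> [0..<m]) \<noteq> None"
      and m2: "\<And>j. j < m \<Longrightarrow> \<not> D n (map \<beta> [0..<j]) \<noteq> None"
      using first_index[of "\<lambda>k. D n (map \<beta> [0..<k]) \<noteq> None", OF D] by blast
    have m: "D n (map \<beta> [0..<m]) \<noteq> None" "\<And>j. j < m \<Longrightarrow> D n (map \<beta> [0..<j]) = None"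
      using m1 m2 by simp_all
    obtain v where v: "D n (map \<beta> [0..<m]) = Some v" using m(1) by auto
    show ?thesis
      unfolding two_ev_def code
    proof (intro exI[of _ m] conjI allI impI)
      show "(if m \<noteq> 0 \<and> D n (map \<beta> [0..<m - 1]) \<noteq> None then the (D n (map \<beta> [0..<m - 1]))
             else if D n (map \<beta> [0..<m]) \<noteq> None then 1 else 0) = 1"
        using m(1) m(2)[of "m - 1"] by auto
      show "(if j \<noteq> 0 \<and> D n (map \<beta> [0..<j - 1]) \<noteq> None then the (D n (map \<beta> [0..<j - 1]))
             else if D n (map \<beta> [0..<j]) \<noteq> None then 1 else 0) \<noteq> 1" if "j < m" for j
        using m(2)[of j] m(2)[of "j - 1"] that by simp
      show "(if Suc m \<noteq> 0 \<and> D n (map \<beta> [0..<Suc m - 1]) \<noteq> None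
             then the (D n (map \<beta> [0..<Suc m - 1]))
             else if D n (map \<beta> [0..<Suc m]) \<noteq> None then 1 else 0) = w"
        using v w[OF v] by simp
    qed
  qed
  show "\<exists>L. \<forall>D D'. (\<forall>n u. length u \<le> L \<longrightarrow> D n u = D' n u) \<longrightarrow> two_code D m = two_code D' m"
    for m
    using two_code_local by blast
qed

theorem pca_kleene_second: "pca kleene_second"
  by (rule kleene.pca)

theorem pca_two_omega: "pca two_omega"
  by (rule two.pca)

end

theory Submission
  imports Defs "HOL-Analysis.Function_Topology"
begin

text \<open>
  Let \<open>f\<close> be the bijection from \<open>2\<^sup>\<omega>\<close> to \<open>\<nat>\<^sup>\<nat>\<close> underlying an isomorphism. For each \<open>m\<close> the test
  \<open>\<beta>(0) = m\<close>, with two distinct constant sequences as answers, is representable in \<open>\<K>\<^sub>2\<close>;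
  transporting a representing element along the inverse morphism gives an element of \<open>2\<^sup>\<omega>\<close> that
  decides \<open>f(\<alpha>)(0) = m\<close>. Application in \<open>2\<^sup>\<omega>\<close> is continuous, so \<open>\<alpha> \<mapsto> f(\<alpha>)(0)\<close> is locally
  constant, hence has finite range because \<open>2\<^sup>\<omega>\<close> is compact. But \<open>f\<close> is surjective.
\<close>

lemma open_agree: "open {\<beta> :: nat \<Rightarrow> nat. agree K \<alpha> \<beta>}"
proof -
  have "{\<beta>. agree K \<alpha> \<beta>} = (\<Inter>i<K. (\<lambda>\<beta>. \<beta> i) -` {\<alpha> i})"
    by (auto simp: agree_def)
  moreover have "open ((\<lambda>\<beta> :: nat \<Rightarrow> nat. \<beta> i) -` {\<alpha> i})" for i
    by (intro open_vimage open_discrete continuous_on_product_coordinates)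
  ultimately show ?thesis by (simp add: open_INT)
qed

text \<open>Tychonoff's theorem for a product of two-point sets: the topology of the type
  \<open>nat \<Rightarrow> nat\<close> is the product of discrete ones.\<close>

lemma compact_two_omega: "compact (carrier two_omega)"
proof -
  have "carrier two_omega = PiE UNIV (\<lambda>_. {0, 1})"
    by (auto simp: two_omega_def PiE_def Pi_def)
  moreover have "compactin (product_topology (\<lambda>_. euclidean) UNIV)
      (PiE UNIV (\<lambda>_. {0, 1}) :: (nat \<Rightarrow> nat) set)"
    unfolding compactin_PiE by (simp add: compactin_euclidean_iff)
  ultimately show ?thesis by (simp add: euclidean_product_topology compactin_euclidean_iff)
qed

text \<open>Each point has a cylinder around it on whose intersection with
  \<open>carrier two_omega\<close> the function \<open>F\<close> is constant. By compactness
  finitely many of them cover, and the values of \<open>F\<close> at their centres exhaust the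
  range.\<close>

lemma locally_constant_finite_range:
  assumes "\<And>\<alpha>. \<alpha> \<in> carrier two_omega \<Longrightarrow>
    \<exists>K. \<forall>\<beta>\<in>carrier two_omega. agree K \<alpha> \<beta> \<longrightarrow> F \<beta> = F \<alpha>"
  shows "finite (F ` carrier two_omega)"
proof -
  let ?C = "carrier two_omega"
  obtain K where K: "\<And>\<alpha> \<beta>. \<alpha> \<in> ?C \<Longrightarrow> \<beta> \<in> ?C \<Longrightarrow> agree (K \<alpha>) \<alpha> \<beta> \<Longrightarrow> F \<beta> = F \<alpha>"
    using assms by metis
  have "?C \<subseteq> (\<Union>\<alpha>\<in>?C. {\<beta>. agree (K \<alpha>) \<alpha> \<beta>})" by auto
  then obtain T where T: "T \<subseteq> ?C" "finite T" "?C \<subseteq> (\<Union>\<alpha>\<in>T. {\<beta>. agree (K \<alpha>) \<alpha> \<beta>})"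
    by (rule compactE_image[OF compact_two_omega open_agree])
  have "F ` ?C \<subseteq> F ` T"
  proof
    fix x assume "x \<in> F ` ?C"
    then obtain \<beta> where \<beta>: "\<beta> \<in> ?C" "x = F \<beta>" by blast
    then obtain \<alpha> where "\<alpha> \<in> T" "agree (K \<alpha>) \<alpha> \<beta>" using T(3) by blast
    with K[of \<alpha> \<beta>] \<beta> T(1) show "x \<in> F ` T" by auto
  qed
  then show ?thesis using T(2) finite_surj by blast
qed

lemma kleene_head_test:
  obtains d where
    "\<And>\<beta>. app kleene_second d \<beta> = Some (\<lambda>_. if \<beta> 0 = m then 1 else 0)"
proof
  \<comment> \<open>An answer is given as soon as one entry has been read, and it does not depend on
    \<open>n\<close>; hence the test is total.\<close>
  define D :: "nat \<Rightarrow> nat list \<Rightarrow> nat option" where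
    "D n u = (if u = [] then None else Some (if hd u = m then 1 else 0))" for n u
  fix \<beta> :: "nat \<Rightarrow> nat"
  have "D n (map \<beta> [0..<Suc 0]) \<noteq> None" for n by (simp add: D_def)
  moreover have "v = (if \<beta> 0 = m then 1 else 0)" if "D n (map \<beta> [0..<k]) = Some v" for n k v
    using that by (cases k) (auto simp: D_def hd_map hd_append split: if_splits)
  ultimately have "kleene_ev (kleene_code D) \<beta> n (if \<beta> 0 = m then 1 else 0)" for n
    by (rule kleene.code_ev)
  then show "app kleene_second (kleene_code D) \<beta> = Some (\<lambda>_. if \<beta> 0 = m then 1 else 0)"
    by (simp add: kleene.app_iff)
qed

text \<open>The composites are equal to the identity relations, so going out along one morphism and
  back along the other can only return to the start. This rules out multiple values in both
  directions.\<close>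

lemma applicative_isomorphism_inverse_bijective:
  assumes "applicative_isomorphism A B \<gamma>"
  obtains \<delta> f where "applicative_morphism B A \<delta>" "bij_betw f (carrier A) (carrier B)"
    "\<And>a b. (b, a) \<in> \<delta> \<longleftrightarrow> a \<in> carrier A \<and> b = f a"
proof -
  obtain \<delta> where \<gamma>: "applicative_morphism A B \<gamma>" and \<delta>: "applicative_morphism B A \<delta>"
    and 1: "\<gamma> O \<delta> = Id_on (carrier A)" and 2: "\<delta> O \<gamma> = Id_on (carrier B)"
    using assms unfolding applicative_isomorphism_def by blast
  have sub: "\<gamma> \<subseteq> carrier A \<times> carrier B" "\<delta> \<subseteq> carrier B \<times> carrier A"
    using \<gamma> \<delta> unfolding applicative_morphism_def by blast+
  have "\<exists>b. (a, b) \<in> \<gamma> \<and> (b, a) \<in> \<delta>" if "a \<in> carrier A" for a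
    using Id_onI[OF that] unfolding 1[symmetric] by blast
  moreover have surj: "\<exists>a. (b, a) \<in> \<delta> \<and> (a, b) \<in> \<gamma>" if "b \<in> carrier B" for b
    using Id_onI[OF that] unfolding 2[symmetric] by blast
  ultimately obtain f where f: "\<And>a. a \<in> carrier A \<Longrightarrow> (a, f a) \<in> \<gamma> \<and> (f a, a) \<in> \<delta>"
    by metis
  have A: "a = a'" if "(a, b) \<in> \<gamma>" "(b, a') \<in> \<delta>" for a a' b
    using that 1 by (metis Id_onE prod.inject relcompI)
  have B: "b = b'" if "(b, a) \<in> \<delta>" "(a, b') \<in> \<gamma>" for a b b'
    using that 2 by (metis Id_onE prod.inject relcompI)
  \<comment> \<open>From left to right, the path from \<open>b\<close> via \<open>a\<close> to
    \<open>f a\<close> lies in \<open>\<delta> O \<gamma>\<close>, whence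
    \<open>b = f a\<close>.\<close>
  have iff: "(b, a) \<in> \<delta> \<longleftrightarrow> a \<in> carrier A \<and> b = f a" for a b
    using f B sub by blast
  have "bij_betw f (carrier A) (carrier B)"
    unfolding bij_betw_def inj_on_def
  proof (intro conjI ballI impI equalityI subsetI)
    show "a = a'" if "a \<in> carrier A" "a' \<in> carrier A" "f a = f a'" for a a'
      using that f A by metis
    show "b \<in> carrier B" if "b \<in> f ` carrier A" for b using that f sub by blast
    show "b \<in> f ` carrier A" if "b \<in> carrier B" for b using surj[OF that] iff by blast
  qed
  with \<delta> iff show thesis using that by blast
qed

theorem proposition2p16:
  shows "\<not> (\<exists>\<gamma>. applicative_isomorphism two_omega kleene_second \<gamma>)"
proof
  let ?C = "carrier two_omega"
  assume "\<exists>\<gamma>. applicative_isomorphism two_omega kleene_second \<gamma>"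
  then obtain \<delta> f where \<delta>: "applicative_morphism kleene_second two_omega \<delta>"
    and bij: "bij_betw f ?C (carrier kleene_second)"
    and iff: "\<And>a b. (b, a) \<in> \<delta> \<longleftrightarrow> a \<in> ?C \<and> b = f a"
    using applicative_isomorphism_inverse_bijective by metis
  have K: "carrier kleene_second = UNIV" by (simp add: kleene_second_def)
  have inj: "inj_on f ?C" and surj: "f ` ?C = UNIV"
    using bij K by (auto simp: bij_betw_def)
  obtain r where r: "\<And>d \<beta> \<beta>' a b. app kleene_second d \<beta> = Some \<beta>' \<Longrightarrow> (d, a) \<in> \<delta> \<Longrightarrow> (\<beta>, b) \<in> \<delta> \<Longrightarrow>
      \<exists>c. (\<beta>', c) \<in> \<delta> \<and> papp two_omega (papp two_omega (Some r) (Some a)) (Some b) = Some c"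
    using \<delta> unfolding applicative_morphism_def K by (simp add: Bex_def Ball_def) blast
  have "\<exists>K. \<forall>b\<in>?C. agree K a b \<longrightarrow> f b 0 = f a 0" if a: "a \<in> ?C" for a
  proof -
    define ans :: "bool \<Rightarrow> nat \<Rightarrow> nat" where "ans x = (\<lambda>_. if x then 1 else 0)" for x
    \<comment> \<open>The value tested for is the one at \<open>a\<close>, so \<open>a\<close>
      itself receives the answer \<open>ans True\<close>.\<close>
    obtain d where d: "\<And>\<beta>. app kleene_second d \<beta> = Some (ans (\<beta> 0 = f a 0))"
      using kleene_head_test[of "f a 0"] unfolding ans_def by blast
    obtain d' where d': "d' \<in> ?C" "f d' = d" using surj by (metis UNIV_I imageE)
    have red: "\<exists>c\<in>?C. f c = ans (f b 0 = f a 0) \<and>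
        papp two_omega (papp two_omega (Some r) (Some d')) (Some b) = Some c" if "b \<in> ?C" for b
      using r[OF d, of d' "f b" b] d' that iff by metis
    \<comment> \<open>The partial application of \<open>r\<close> to \<open>d'\<close> does not
      involve \<open>b\<close>, so the single element \<open>e\<close> performs the transported test
      on all of \<open>?C\<close>.\<close>
    obtain e where e: "app two_omega r d' = Some e"
      using red[OF a] by (auto simp: papp_def bind_eq_Some_conv)
    have app: "\<exists>c\<in>?C. f c = ans (f b 0 = f a 0) \<and> app two_omega e b = Some c" if "b \<in> ?C" for b
      using red[OF that] e by (simp add: papp_def)
    obtain t where t: "t \<in> ?C" "f t = ans True" "app two_omega e a = Some t"
      using app[OF a] by auto
    obtain u where u: "u \<in> ?C" "f u = ans False" using surj by (metis UNIV_I imageE)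
    have "ans True \<noteq> ans False" by (simp add: ans_def fun_eq_iff)
    \<comment> \<open>By injectivity of \<open>f\<close>, \<open>t\<close> and \<open>u\<close> are
      the only possible outputs of \<open>e\<close>; one digit tells them apart, so continuity at
      the single argument \<open>n\<close> suffices.\<close>
    then obtain n where n: "t n \<noteq> u n" using t u by (metis ext)
    have "two_ev e a n (t n)" using t(3) by (simp add: two.app_iff)
    then obtain K where ev: "\<And>b. agree K a b \<Longrightarrow> two_ev e b n (t n)"
      using two.ev_open by (metis agree_refl)
    have "f b 0 = f a 0" if b: "b \<in> ?C" "agree K a b" for b
    proof (rule ccontr)
      assume "f b 0 \<noteq> f a 0"
      then obtain c where c: "c \<in> ?C" "f c = ans False" "app two_omega e b = Some c"
        using app[OF b(1)] by auto
      then have "c = u" using inj u by (metis inj_onD)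
      moreover have "c n = t n" using c(3) ev[OF b(2)] two.ev_fun by (metis two.app_iff)
      ultimately show False using n by simp
    qed
    then show ?thesis by blast
  qed
  then have "finite ((\<lambda>a. f a 0) ` ?C)"
    by (rule locally_constant_finite_range)
  moreover have "(\<lambda>a. f a 0) ` ?C = (\<lambda>\<beta>. \<beta> 0) ` f ` ?C" by (simp add: image_image)
  \<comment> \<open>Constant sequences attain every first entry.\<close>
  moreover have "(\<lambda>\<beta> :: nat \<Rightarrow> nat. \<beta> 0) ` UNIV = UNIV"
    by (rule surjI[of _ "\<lambda>m _. m"]) simp
  ultimately show False using surj by simp
qed

end
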